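(* Let $n\in\mathbb N$ be such that $n=3\cdot2^{\ell(n)-1}+k$, where $\ell(n)\ge 1$ is an integer and $1\le k\le2^{\ell(n)-1}-1$. Let $I\subseteq\{1,2\}^{\ell(n)-1}$ with $\mathrm{card}(I)=k=n-3\cdot2^{\ell(n)-1}$. Then, for each admissible choice of the sets $A_\sigma$, the set $$\alpha_n(I)=\Big(\bigcup_{\sigma\in\{1,2\}^{\ell(n)-1}\setminus I}A_\sigma\Big)\cup\left\{S_{\sigma\tau}\left(\tfrac12\right):\sigma\in I\text{ and }\tau\in\{1,2\}^2\right\}$$ forms a CVT with $n$-means for $P$. The number of such sets (over all choices of $I$ and of the $A_\sigma$) is $2^{2^{\ell(n)+1}-n}\binom{2^{\ell(n)-1}}{n-3\cdot2^{\ell(n)-1}}$.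
   Context: Let $S_1(x)=\frac49x$ and $S_2(x)=\frac49x+\frac59$ on $\mathbb R$, and let $P$ be the unique Borel probability measure on $\mathbb R$ with $P=\frac12P\circ S_1^{-1}+\frac12P\circ S_2^{-1}$. For a word $\sigma=\sigma_1\cdots\sigma_k\in\{1,2\}^k$ put $S_\sigma=S_{\sigma_1}\circ\cdots\circ S_{\sigma_k}$ and $J_\sigma=S_\sigma([0,1])$; $\emptyset$ is the empty word ($S_\emptyset=\mathrm{id}$, $\{1,2\}^0=\{\emptyset\}$), and $\sigma\tau$ denotes concatenation. For words $\beta,\gamma,\dots,\delta$, $$a(\beta,\gamma,\dots,\delta)=\frac{1}{P(J_\beta\cup J_\gamma\cup\cdots\cup J_\delta)}\int_{J_\beta\cup J_\gamma\cup\cdots\cup J_\delta}x\,dP(x).$$ For each word $\sigma$, $A_\sigma$ denotes one of the following two sets (chosen arbitrarily and independently for each $\sigma$): $\{a(\sigma11,\sigma121,\sigma1221),\ a(\sigma1222,\sigma21),\ a(\sigma22)\}$ or $\{a(\sigma11),\ a(\sigma12,\sigma2111),\ a(\sigma2112,\sigma212,\sigma22)\}$. For a finite set $\alpha\subset\mathbb R$, the Voronoi region of $a\in\alpha$ is $M(a|\alpha)=\{x\in\mathbb R:|x-a|=\min_{b\in\alpha}|x-b|\}$. A set $\alpha$ of $n$ points forms a centroidal Voronoi tessellation (CVT) with $n$-means (for $P$) if for every $a\in\alpha$ we have $P(M(a|\alpha))>0$ and $a=\frac{1}{P(M(a|\alpha))}\int_{M(a|\alpha)}x\,dP(x)$.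 *)

theory Defs
  imports "HOL-Probability.Probability"
begin

(* Words are lists over {1,2}; the value of ifs_map at other letters is irrelevant. *)

definition words :: "nat \<Rightarrow> nat list set" where
  "words k = {\<sigma>. length \<sigma> = k \<and> set \<sigma> \<subseteq> {1, 2}}"

definition ifs_map :: "nat \<Rightarrow> real \<Rightarrow> real" where
  "ifs_map i x = (if i = 1 then 4/9 * x else 4/9 * x + 5/9)"

definition word_map :: "nat list \<Rightarrow> real \<Rightarrow> real" where
  "word_map \<sigma> = foldr (\<lambda>i f. ifs_map i \<circ> f) \<sigma> id"

definition word_interval :: "nat list \<Rightarrow> real set" where
  "word_interval \<sigma> = word_map \<sigma> ` {0..1}"

definition self_similar_prob :: "real measure \<Rightarrow> bool" where
  "self_similar_prob P \<longleftrightarrow>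
     prob_space P \<and> sets P = sets borel \<and>
     (\<forall>B \<in> sets borel.
        measure P B = 1/2 * measure P (ifs_map 1 -` B) + 1/2 * measure P (ifs_map 2 -` B))"

definition centroid :: "real measure \<Rightarrow> real set \<Rightarrow> real" where
  "centroid P B = 1 / measure P B * (LINT x:B|P. x)"

definition words_centroid :: "real measure \<Rightarrow> nat list set \<Rightarrow> real" where
  "words_centroid P W = centroid P (\<Union>\<beta>\<in>W. word_interval \<beta>)"

definition triple_left :: "real measure \<Rightarrow> nat list \<Rightarrow> real set" where
  "triple_left P \<sigma> =
     {words_centroid P {\<sigma> @ [1,1], \<sigma> @ [1,2,1], \<sigma> @ [1,2,2,1]},
      words_centroid P {\<sigma> @ [1,2,2,2], \<sigma> @ [2,1]},
      words_centroid P {\<sigma> @ [2,2]}}"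

definition triple_right :: "real measure \<Rightarrow> nat list \<Rightarrow> real set" where
  "triple_right P \<sigma> =
     {words_centroid P {\<sigma> @ [1,1]},
      words_centroid P {\<sigma> @ [1,2], \<sigma> @ [2,1,1,1]},
      words_centroid P {\<sigma> @ [2,1,1,2], \<sigma> @ [2,1,2], \<sigma> @ [2,2]}}"

definition admissible_choice :: "real measure \<Rightarrow> (nat list \<Rightarrow> real set) \<Rightarrow> bool" where
  "admissible_choice P A \<longleftrightarrow>
     (\<forall>k. \<forall>\<sigma> \<in> words k. A \<sigma> = triple_left P \<sigma> \<or> A \<sigma> = triple_right P \<sigma>)"

(* In alpha_set A m J, the number m is the common length of the words indexing the blocks. *)
definition alpha_set :: "(nat list \<Rightarrow> real set) \<Rightarrow> nat \<Rightarrow> nat list set \<Rightarrow> real set" where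
  "alpha_set A m J =
     (\<Union>\<sigma> \<in> words m - J. A \<sigma>) \<union>
     {word_map (\<sigma> @ \<tau>) (1/2) | \<sigma> \<tau>. \<sigma> \<in> J \<and> \<tau> \<in> words 2}"

definition voronoi_region :: "real \<Rightarrow> real set \<Rightarrow> real set" where
  "voronoi_region a \<alpha> = {x. \<bar>x - a\<bar> = Min ((\<lambda>b. \<bar>x - b\<bar>) ` \<alpha>)}"

definition CVT :: "real measure \<Rightarrow> nat \<Rightarrow> real set \<Rightarrow> bool" where
  "CVT P n \<alpha> \<longleftrightarrow>
     finite \<alpha> \<and> card \<alpha> = n \<and>
     (\<forall>a \<in> \<alpha>. measure P (voronoi_region a \<alpha>) > 0 \<and> a = centroid P (voronoi_region a \<alpha>))"

end

theory Submission
  imports Defs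
begin

text \<open>
  Everything happens inside the blocks \<open>S\<^sub>\<sigma>([0,1])\<close> of one fixed level \<open>m = l - 1\<close>.
  Because \<open>P\<close> restricted to a block is a scaled copy of \<open>P\<close>, and centroids are carried along by
  affine maps, it suffices to understand three ways of cutting the unit interval into finitely
  many cells, each a finite union of cylinders: the two ways with three cells that define the
  sets \<open>A\<^sub>\<sigma>\<close>, and the cut into the four cylinders of level two.

  In each of them every cell lies strictly closer to its own centroid than to the
  centroids of the other cells; since \<open>P\<close> has mean \<open>1/2\<close> and gives mass \<open>2\<^sup>-\<^sup>k\<close> to a
  cylinder of level \<open>k\<close>, this is arithmetic with explicit fractions.  The predicate
  \<open>tessellates\<close> collects what is needed of such a cut.

  Different blocks do not interfere.  A competitor \<open>b\<close> is at least as close to \<open>x\<close> as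
  the centroid \<open>a\<close> exactly if \<open>b\<close> lies between \<open>a\<close> and \<open>2 * x - a\<close>,
  the mirror image of \<open>a\<close> in \<open>x\<close>.
  For \<open>x\<close> in the cell of \<open>a\<close> that mirror image leaves the block by at most a fifth of the
  length of the block, whereas the gap to the next block is at least a quarter of that
  length (\<open>halo_disjoint\<close>).  Therefore any mixture of the three cuts, one for each
  block, gives a centroidal Voronoi tessellation (\<open>CVT_of_tessellations\<close>): up to a null set
  the Voronoi regions are the cells.

  For the count, the points of a tessellation that lie in a given block determine which of the
  three cuts was used there, because the three sets of centroids are different.  So the
  sets are in bijection with pairs of a \<open>k\<close>-element set of blocks cut into quarters and an
  arbitrary subset of the \<open>2\<^sup>m - k\<close> remaining blocks, those with the first triple.
\<close>

section \<open>Affine geometry of the cylinder maps\<close>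

lemma word_map_Nil [simp]: "word_map [] x = x"
  by (simp add: word_map_def)

lemma word_map_Cons [simp]: "word_map (i # w) x = ifs_map i (word_map w x)"
  by (simp add: word_map_def)

lemma word_map_append: "word_map (v @ w) x = word_map v (word_map w x)"
  by (induction v) simp_all

lemma word_map_affine: "word_map w x = (4/9) ^ length w * x + word_map w 0"
  by (induction w) (auto simp: ifs_map_def algebra_simps)

lemma word_map_diff: "word_map w x - word_map w y = (4/9) ^ length w * (x - y)"
  using word_map_affine[of w x] word_map_affine[of w y] by (simp add: algebra_simps)

lemma abs_word_map_diff: "\<bar>word_map w x - word_map w y\<bar> = (4/9) ^ length w * \<bar>x - y\<bar>"
  by (simp add: word_map_diff abs_mult)

lemma inj_word_map: "inj (word_map w)"
proof (rule injI)
  fix x y assume "word_map w x = word_map w y"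
  then show "x = y" using word_map_diff[of w x y] by simp
qed

lemma surj_word_map: "\<exists>y. x = word_map w y"
  using word_map_affine[of w "(x - word_map w 0) / (4/9) ^ length w"]
  by (intro exI[of _ "(x - word_map w 0) / (4/9) ^ length w"]) simp

lemma ifs_map_unit_interval: "x \<in> {0..1} \<Longrightarrow> ifs_map i x \<in> {0..1}"
  by (auto simp: ifs_map_def)

lemma word_map_unit_interval: "x \<in> {0..1} \<Longrightarrow> word_map w x \<in> {0..1}"
proof (induction w)
  case (Cons i w)
  then show ?case using ifs_map_unit_interval[of "word_map w x" i] by simp
qed simp

lemma word_interval_subset: "word_interval w \<subseteq> {0..1}"
  using word_map_unit_interval by (auto simp: word_interval_def simp del: atLeastAtMost_iff)

lemma word_interval_append: "word_interval (v @ w) = word_map v ` word_interval w"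
  by (auto simp: word_interval_def word_map_append image_image)

lemma word_interval_eq: "word_interval w = {word_map w 0..word_map w 1}"
proof -
  have "word_map w = (\<lambda>x. (4/9) ^ length w * x + word_map w 0)"
    using word_map_affine by blast
  then have "word_interval w = (\<lambda>x. (4/9) ^ length w * x + word_map w 0) ` {0..1}"
    unfolding word_interval_def by metis
  also have "\<dots> = {word_map w 0..(4/9) ^ length w + word_map w 0}"
    by (subst image_affinity_atLeastAtMost) auto
  finally show ?thesis using word_map_affine[of w 1] by simp
qed

lemma word_map_halo:
  assumes "x \<in> {-1/5..6/5}" shows "word_map w x \<in> {-1/5..6/5}"
  using assms by (induction w) (auto simp: ifs_map_def)

text \<open>
  Neighbouring cylinders of the same level are separated by gaps of at least a quarter
  of their length, so that enlarging one of them by a fifth on either side still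
  keeps it away from all the others.
\<close>

lemma halo_disjoint:
  assumes "length v = length w" "set v \<subseteq> {1, 2}" "set w \<subseteq> {1, 2}" "v \<noteq> w"
    and "x \<in> {-1/5..6/5}" "y \<in> {0..1}"
  shows "word_map v x \<noteq> word_map w y"
  using assms(1-4)
proof (induction v w rule: list_induct2)
  case (Cons i v j w)
  have x: "word_map v x \<in> {-1/5..6/5}" using assms(5) by (rule word_map_halo)
  have y: "word_map w y \<in> {0..1}" using assms(6) by (rule word_map_unit_interval)
  show ?case
  proof (cases "i = j")
    case True
    then show ?thesis using Cons by (auto simp: ifs_map_def)
  next
    case False
    then have "(i = 1 \<and> j = 2) \<or> (i = 2 \<and> j = 1)" using Cons.prems by auto
    then show ?thesis using x y by (auto simp: ifs_map_def)
  qed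
qed simp

lemma word_interval_disjoint:
  assumes "v \<in> words m" "w \<in> words m" "v \<noteq> w"
  shows "word_interval v \<inter> word_interval w = {}"
  using halo_disjoint[of v w] assms by (fastforce simp: words_def word_interval_def)

lemma words_0: "words 0 = {[]}"
  by (auto simp: words_def)

lemma words_Suc: "words (Suc m) = (#) 1 ` words m \<union> (#) 2 ` words m"
proof (intro equalityI subsetI)
  fix w assume "w \<in> words (Suc m)"
  then show "w \<in> (#) 1 ` words m \<union> (#) 2 ` words m"
    by (cases w) (auto simp: words_def)
qed (auto simp: words_def)

lemma finite_words: "finite (words m)"
  by (induction m) (auto simp: words_0 words_Suc)

lemma card_words: "card (words m) = 2 ^ m"
proof (induction m)
  case (Suc m)
  have "card (words (Suc m)) = card ((#) 1 ` words m) + card ((#) 2 ` words m)"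
    unfolding words_Suc by (rule card_Un_disjoint) (auto simp: finite_words)
  then show ?case using Suc by (simp add: card_image)
qed (simp add: words_0)

section \<open>Self-similarity of the measure\<close>

lemma ifs_map_affine: "ifs_map i x = 4/9 * x + ifs_map i 0"
  by (simp add: ifs_map_def)

lemma inj_ifs_map: "inj (ifs_map i)"
  by (rule injI) (auto simp: ifs_map_def split: if_splits)

lemma ifs_map_measurable [measurable]: "ifs_map i \<in> borel_measurable borel"
  unfolding ifs_map_def by measurable

lemma ifs_map_image_borel:
  assumes "B \<in> sets borel" shows "ifs_map i ` B \<in> sets borel"
proof -
  define g where "g y = (if i = 1 then 9/4 * y else 9/4 * (y - 5/9))" for y :: real
  have gi: "g (ifs_map i x) = x" "ifs_map i (g x) = x" for x
    by (auto simp: g_def ifs_map_def field_simps)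
  have "ifs_map i ` B = g -` B" using gi by (auto simp: image_iff) metis
  moreover have "g \<in> borel_measurable borel" unfolding g_def by measurable
  ultimately show ?thesis using assms measurable_sets[of g borel borel B] by simp
qed

lemma word_map_image_borel: "B \<in> sets borel \<Longrightarrow> word_map w ` B \<in> sets borel"
proof (induction w)
  case (Cons i w)
  have "word_map (i # w) ` B = ifs_map i ` (word_map w ` B)" by auto
  then show ?case using Cons ifs_map_image_borel by simp
qed simp

lemma word_interval_borel [measurable]: "word_interval w \<in> sets borel"
  by (simp add: word_interval_eq)

locale self_similar = prob_space P for P :: "real measure" +
  assumes sets_P [simp, measurable_cong]: "sets P = sets borel"
    and self_sim: "B \<in> sets borel \<Longrightarrow>
      measure P B = 1/2 * measure P (ifs_map 1 -` B) + 1/2 * measure P (ifs_map 2 -` B)"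
begin

lemma space_P [simp]: "space P = UNIV"
  using sets_eq_imp_space_eq[OF sets_P] by simp

lemma borel_measurable_P [simp]: "f \<in> borel_measurable P \<longleftrightarrow> f \<in> borel_measurable borel"
  by (rule arg_cong[where f="\<lambda>S. f \<in> S"]) (rule measurable_cong_sets, simp_all)

text \<open>
  A half-line beyond one end of the unit interval pulls back to half-lines that are at
  least \<open>9/4\<close> times as far from that end.
  Iterating, its mass is at most that of a half-line arbitrarily far away, hence zero.
\<close>

lemma null_by_expansion:
  fixes H :: "real \<Rightarrow> real set"
  assumes H [measurable]: "\<And>u. H u \<in> sets borel"
    and anti: "\<And>u v. u \<le> v \<Longrightarrow> H v \<subseteq> H u"
    and empty: "(\<Inter>n. H (real n)) = {}"
    and pull: "\<And>i u. 0 < u \<Longrightarrow> ifs_map i -` H u \<subseteq> H (9/4 * u)"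
    and "0 < u"
  shows "measure P (H u) = 0"
proof -
  have step: "measure P (H u) \<le> measure P (H (9/4 * u))" if "0 < u" for u
  proof -
    have "measure P (ifs_map i -` H u) \<le> measure P (H (9/4 * u))" for i
      by (rule finite_measure_mono) (use pull[OF that] in auto)
    from this[of 1] this[of 2] show ?thesis using self_sim[OF H, of u] by linarith
  qed
  have iter: "measure P (H u) \<le> measure P (H ((9/4) ^ n * u))" for n
  proof (induction n)
    case (Suc n)
    have "measure P (H ((9/4) ^ n * u)) \<le> measure P (H (9/4 * ((9/4) ^ n * u)))"
      by (rule step) (use \<open>0 < u\<close> in simp)
    with Suc show ?case by (simp add: mult.assoc)
  qed simp
  have lim: "(\<lambda>n. measure P (H (real n))) \<longlonglongrightarrow> measure P (\<Inter>n. H (real n))"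
    by (rule finite_Lim_measure_decseq) (auto simp: decseq_def intro!: anti)
  have "measure P (H u) \<le> measure P (H (real n))" for n
  proof -
    obtain k where "real n / u < (9/4) ^ k" using real_arch_pow[of "9/4" "real n / u"] by auto
    then have "real n \<le> (9/4) ^ k * u" using \<open>0 < u\<close> by (simp add: field_simps)
    then have "measure P (H ((9/4) ^ k * u)) \<le> measure P (H (real n))"
      by (intro finite_measure_mono anti) auto
    with iter[of k] show ?thesis by simp
  qed
  then have "measure P (H u) \<le> measure P (\<Inter>n. H (real n))"
    by (intro LIMSEQ_le_const[OF lim]) auto
  then show ?thesis using empty by (simp add: measure_le_0_iff)
qed

text \<open>
  Self-similarity alone forces the support into the unit interval: both half-lines outside
  are exhausted by half-lines that the preceding lemma shows to be null.
\<close>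

lemma AE_unit_interval: "AE x in P. x \<in> {0..1}"
proof -
  have "measure P {1 + u<..} = 0" if "0 < u" for u
  proof (rule null_by_expansion[of "\<lambda>u. {1 + u<..}"])
    show "(\<Inter>n. {1 + real n<..}) = {}"
    proof (intro equals0I)
      fix x assume x: "x \<in> (\<Inter>n. {1 + real n<..})"
      obtain n where "x \<le> real n" using real_arch_simple by blast
      moreover have "1 + real n < x" using x by blast
      ultimately show False by simp
    qed
  qed (use that in \<open>auto simp: ifs_map_def split: if_splits\<close>)
  moreover have "measure P {..<- u} = 0" if "0 < u" for u
  proof (rule null_by_expansion[of "\<lambda>u. {..<- u}"])
    show "(\<Inter>n. {..<- real n}) = {}"
    proof (intro equals0I)
      fix x assume x: "x \<in> (\<Inter>n. {..<- real n})"
      obtain n where "- x \<le> real n" using real_arch_simple by blast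
      moreover have "x < - real n" using x by blast
      ultimately show False by simp
    qed
  qed (use that in \<open>auto simp: ifs_map_def split: if_splits\<close>)
  ultimately have "AE x in P. x \<notin> {1 + 1 / real (Suc n)<..}" "AE x in P. x \<notin> {..<- (1 / real (Suc n))}" for n
    by (intro AE_not_in null_setsI; simp add: emeasure_eq_measure del: of_nat_Suc)+
  then have "AE x in P. \<forall>n. x \<notin> {1 + 1 / real (Suc n)<..} \<and> x \<notin> {..<- (1 / real (Suc n))}"
    by (simp add: AE_all_countable)
  then show ?thesis
  proof (eventually_elim)
    case (elim x)
    show ?case
    proof (rule ccontr)
      assume "x \<notin> {0..1}"
      then have "0 < max (- x) (x - 1)" by auto
      then obtain n where "1 / real (Suc n) < max (- x) (x - 1)"
        using nat_approx_posE by metis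
      with elim[rule_format, of n] show False by (auto simp del: of_nat_Suc)
    qed
  qed
qed

text \<open>
  Self-similarity is given for measures of sets; the standard induction over nonnegative
  measurable functions carries it over to integrals.
\<close>

lemma nn_integral_self_sim:
  assumes "f \<in> borel_measurable borel"
  shows "(\<integral>\<^sup>+x. f x \<partial>P) = 1/2 * (\<integral>\<^sup>+x. f (ifs_map 1 x) \<partial>P) + 1/2 * (\<integral>\<^sup>+x. f (ifs_map 2 x) \<partial>P)"
  using assms
proof (induction f rule: borel_measurable_induct)
  case (cong f g)
  then show ?case by simp
next
  case (set B)
  have *: "(\<integral>\<^sup>+x. indicator B (ifs_map i x) \<partial>P) = emeasure P (ifs_map i -` B)" for i
  proof -
    have "ifs_map i -` B \<in> sets borel"
      using measurable_sets[OF ifs_map_measurable set, of i] by simp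
    moreover have "(\<lambda>x. indicator B (ifs_map i x)) = (indicator (ifs_map i -` B) :: real \<Rightarrow> ennreal)"
      by (simp add: fun_eq_iff indicator_def)
    ultimately show ?thesis by (metis nn_integral_indicator sets_P)
  qed
  have "emeasure P B = ennreal (1/2 * measure P (ifs_map 1 -` B) + 1/2 * measure P (ifs_map 2 -` B))"
    using self_sim[OF set] by (simp add: emeasure_eq_measure)
  also have "\<dots> = ennreal (1/2) * emeasure P (ifs_map 1 -` B) + ennreal (1/2) * emeasure P (ifs_map 2 -` B)"
    by (simp only: emeasure_eq_measure ennreal_mult ennreal_plus measure_nonneg mult_nonneg_nonneg
        divide_nonneg_nonneg zero_le_one zero_le_numeral)
  also have "ennreal (1/2) = 1/2" by (simp add: ennreal_divide_numeral[of 1, symmetric] del: ennreal_half)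
  finally show ?case using set by (simp add: * )
next
  case (mult u c)
  then show ?case by (simp add: nn_integral_cmult distrib_left mult.left_commute)
next
  case (add u v)
  then show ?case by (simp add: nn_integral_add distrib_left algebra_simps)
next
  case (seq U)
  have m: "(\<lambda>x. U n (ifs_map i x)) \<in> borel_measurable borel" for n i using seq(1) by measurable
  have incr: "U k x \<le> U n x" if "k \<le> n" for k n x
    using \<open>incseq U\<close> that by (auto simp: incseq_def le_fun_def)
  have "(\<integral>\<^sup>+x. (SUP n. U n x) \<partial>P) = (SUP n. \<integral>\<^sup>+x. U n x \<partial>P)"
    by (rule nn_integral_monotone_convergence_SUP) (use seq in auto)
  also have "\<dots> = (SUP n. 1/2 * (\<integral>\<^sup>+x. U n (ifs_map 1 x) \<partial>P) + 1/2 * (\<integral>\<^sup>+x. U n (ifs_map 2 x) \<partial>P))"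
    using seq by simp
  also have "\<dots> = (SUP n. 1/2 * (\<integral>\<^sup>+x. U n (ifs_map 1 x) \<partial>P)) + (SUP n. 1/2 * (\<integral>\<^sup>+x. U n (ifs_map 2 x) \<partial>P))"
    by (intro ennreal_SUP_add) (auto simp: incseq_def intro!: mult_left_mono nn_integral_mono incr)
  also have "\<dots> = 1/2 * (SUP n. \<integral>\<^sup>+x. U n (ifs_map 1 x) \<partial>P) + 1/2 * (SUP n. \<integral>\<^sup>+x. U n (ifs_map 2 x) \<partial>P)"
    by (simp add: SUP_mult_left_ennreal)
  also have "(SUP n. \<integral>\<^sup>+x. U n (ifs_map 1 x) \<partial>P) = (\<integral>\<^sup>+x. (SUP n. U n (ifs_map 1 x)) \<partial>P)"
    by (rule nn_integral_monotone_convergence_SUP[symmetric]) (use seq m in \<open>auto simp: incseq_def le_fun_def\<close>)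
  also have "(SUP n. \<integral>\<^sup>+x. U n (ifs_map 2 x) \<partial>P) = (\<integral>\<^sup>+x. (SUP n. U n (ifs_map 2 x)) \<partial>P)"
    by (rule nn_integral_monotone_convergence_SUP[symmetric]) (use seq m in \<open>auto simp: incseq_def le_fun_def\<close>)
  finally show ?case by (simp add: image_comp)
qed

lemma integral_self_sim:
  fixes f :: "real \<Rightarrow> real"
  assumes [measurable]: "f \<in> borel_measurable borel" and b: "\<And>x. 0 \<le> f x" "\<And>x. f x \<le> C"
  shows "(\<integral>x. f x \<partial>P) = 1/2 * (\<integral>x. f (ifs_map 1 x) \<partial>P) + 1/2 * (\<integral>x. f (ifs_map 2 x) \<partial>P)"
proof -
  have eq: "(\<integral>\<^sup>+x. ennreal (g x) \<partial>P) = ennreal (\<integral>x. g x \<partial>P)"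
    if "g \<in> borel_measurable borel" "\<And>x. 0 \<le> g x" "\<And>x. g x \<le> C" for g
    by (intro nn_integral_eq_integral integrable_const_bound[where B=C]) (use that in auto)
  have "ennreal (\<integral>x. f x \<partial>P) = (\<integral>\<^sup>+x. ennreal (f x) \<partial>P)"
    using b by (intro eq[symmetric]) auto
  also have "\<dots> = 1/2 * (\<integral>\<^sup>+x. ennreal (f (ifs_map 1 x)) \<partial>P) + 1/2 * (\<integral>\<^sup>+x. ennreal (f (ifs_map 2 x)) \<partial>P)"
    by (rule nn_integral_self_sim) measurable
  also have "\<dots> = 1/2 * ennreal (\<integral>x. f (ifs_map 1 x) \<partial>P) + 1/2 * ennreal (\<integral>x. f (ifs_map 2 x) \<partial>P)"
    using b by (subst (1 2) eq) auto
  also have "1/2 = ennreal (1/2)" by (simp add: ennreal_divide_numeral[of 1, symmetric] del: ennreal_half)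
  also have "ennreal (1/2) * ennreal (\<integral>x. f (ifs_map 1 x) \<partial>P) + ennreal (1/2) * ennreal (\<integral>x. f (ifs_map 2 x) \<partial>P)
    = ennreal (1/2 * (\<integral>x. f (ifs_map 1 x) \<partial>P) + 1/2 * (\<integral>x. f (ifs_map 2 x) \<partial>P))"
    using b by (simp only: ennreal_mult ennreal_plus integral_nonneg_AE AE_I2 mult_nonneg_nonneg
        divide_nonneg_nonneg zero_le_one zero_le_numeral)
  finally show ?thesis
    using b by (subst (asm) ennreal_inj) (auto intro!: integral_nonneg_AE add_nonneg_nonneg)
qed

lemma AE_ifs_map_unit_interval: "AE x in P. ifs_map i x \<in> {0..1}"
  using AE_unit_interval by eventually_elim (rule ifs_map_unit_interval)

text \<open>
  Of the two halves of a self-similar integral only one survives on a set inside the range of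
  \<open>ifs_map i\<close>: the other map sends the unit interval to the far side of the central gap.
\<close>

lemma set_integral_ifs_image:
  fixes g :: "real \<Rightarrow> real"
  assumes B [measurable]: "B \<in> sets borel" and sub: "B \<subseteq> {0..1}"
    and g [measurable]: "g \<in> borel_measurable borel"
    and bound: "\<And>x. x \<in> {0..1} \<Longrightarrow> 0 \<le> g x \<and> g x \<le> C"
  shows "(LINT x:(ifs_map i ` B)|P. g x) = 1/2 * (LINT x:B|P. g (ifs_map i x))"
proof -
  define f where "f x = indicator (ifs_map i ` B) x * g x" for x
  have [measurable]: "ifs_map i ` B \<in> sets borel" by (rule ifs_map_image_borel) (rule B)
  have f [measurable]: "f \<in> borel_measurable borel" unfolding f_def by measurable
  have "0 \<le> C" using bound[of 0] by auto
  moreover have "ifs_map i ` B \<subseteq> {0..1}" using sub ifs_map_unit_interval by blast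
  ultimately have f_bound: "0 \<le> f x" "f x \<le> C" for x
    using bound by (auto simp: f_def indicator_def)
  have same: "f (ifs_map i x) = indicator B x * g (ifs_map i x)" for x
    by (simp add: f_def indicator_def inj_image_mem_iff[OF inj_ifs_map])
  \<comment> \<open>Almost surely \<open>x\<close> lies in the unit interval, so the other map sends it outside the image of \<open>B\<close>.\<close>
  have other: "(\<integral>x. f (ifs_map j x) \<partial>P) = 0" if "(i = 1) \<noteq> (j = 1)" for j
  proof -
    have "AE x in P. f (ifs_map j x) = 0"
      using AE_unit_interval
    proof eventually_elim
      case (elim x)
      have "ifs_map j x \<notin> ifs_map i ` B"
      proof
        assume "ifs_map j x \<in> ifs_map i ` B"
        then obtain y where "y \<in> B" "ifs_map j x = ifs_map i y" by auto
        then show False using sub elim that by (cases "i = 1") (auto simp: ifs_map_def)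
      qed
      then show ?case by (simp add: f_def)
    qed
    then show ?thesis by (intro integral_eq_zero_AE)
  qed
  have "(\<integral>x. f x \<partial>P) = 1/2 * (\<integral>x. f (ifs_map i x) \<partial>P)"
  proof (cases "i = 1")
    case True
    then show ?thesis using integral_self_sim[OF f f_bound] other[of 2] by simp
  next
    case False
    then have "ifs_map i = ifs_map 2" by (simp add: ifs_map_def fun_eq_iff)
    then show ?thesis using integral_self_sim[OF f f_bound] other[of 1] False by simp
  qed
  then show ?thesis unfolding set_lebesgue_integral_def real_scaleR_def same by (simp add: f_def)
qed

lemma set_integral_one: "B \<in> sets borel \<Longrightarrow> (LINT x:B|P. 1) = measure P B"
  by (simp add: set_lebesgue_integral_def)

lemma measure_ifs_image:
  assumes "B \<in> sets borel" "B \<subseteq> {0..1}"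
  shows "measure P (ifs_map i ` B) = 1/2 * measure P B"
  using set_integral_ifs_image[OF assms, of "\<lambda>_. 1" 1 i] assms
  by (simp add: set_integral_one ifs_map_image_borel)

lemma set_integrable_id:
  assumes [measurable]: "B \<in> sets borel" and "B \<subseteq> {0..1}"
  shows "set_integrable P B (\<lambda>x. x)"
  unfolding set_integrable_def
  by (rule integrable_const_bound[where B=1])
    (use assms in \<open>auto intro!: AE_I2 split: split_indicator\<close>)

lemma set_integral_affine:
  assumes B: "B \<in> sets borel" "B \<subseteq> {0..1}"
  shows "(LINT x:B|P. a * x + b) = a * (LINT x:B|P. x) + b * measure P B"
proof -
  have "set_integrable P B (\<lambda>x. a * x)" using set_integrable_id[OF B] by simp
  moreover have "set_integrable P B (\<lambda>x. b)"
    unfolding set_integrable_def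
    by (rule integrable_const_bound[where B="\<bar>b\<bar>"])
      (use B in \<open>auto intro!: AE_I2 split: split_indicator\<close>)
  ultimately have "(LINT x:B|P. a * x + b) = (LINT x:B|P. a * x) + (LINT x:B|P. b)"
    by (rule set_integral_add)
  also have "(LINT x:B|P. b) = b * measure P B"
    using B by (simp add: set_lebesgue_integral_def)
  finally show ?thesis by simp
qed

lemma centroid_ifs_image:
  assumes B: "B \<in> sets borel" "B \<subseteq> {0..1}" and pos: "0 < measure P B"
  shows "centroid P (ifs_map i ` B) = ifs_map i (centroid P B)"
proof -
  have "(LINT x:(ifs_map i ` B)|P. x) = 1/2 * (LINT x:B|P. ifs_map i x)"
    by (rule set_integral_ifs_image[where C=1]) (use B in auto)
  also have "(LINT x:B|P. ifs_map i x) = 4/9 * (LINT x:B|P. x) + ifs_map i 0 * measure P B"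
    by (subst ifs_map_affine) (rule set_integral_affine[OF B])
  finally show ?thesis
    using pos ifs_map_affine[of i "centroid P B"]
    by (simp add: centroid_def measure_ifs_image[OF B] field_simps)
qed

lemma measure_word_image:
  assumes B: "B \<in> sets borel" "B \<subseteq> {0..1}"
  shows "measure P (word_map w ` B) = (1/2) ^ length w * measure P B"
proof (induction w)
  case (Cons i w)
  have "word_map (i # w) ` B = ifs_map i ` (word_map w ` B)" by auto
  moreover have "word_map w ` B \<subseteq> {0..1}" using B word_map_unit_interval by blast
  ultimately show ?case using Cons measure_ifs_image word_map_image_borel[OF B(1)] by simp
qed simp

lemma centroid_word_image:
  assumes B: "B \<in> sets borel" "B \<subseteq> {0..1}" and pos: "0 < measure P B"
  shows "centroid P (word_map w ` B) = word_map w (centroid P B)"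
proof (induction w)
  case (Cons i w)
  have "word_map (i # w) ` B = ifs_map i ` (word_map w ` B)" by auto
  moreover have "word_map w ` B \<subseteq> {0..1}" using B word_map_unit_interval by blast
  moreover have "0 < measure P (word_map w ` B)" using pos by (simp add: measure_word_image[OF B])
  ultimately show ?case using Cons centroid_ifs_image word_map_image_borel[OF B(1)] by simp
qed simp

lemma measure_unit_interval: "measure P {0..1} = 1"
  using AE_unit_interval by (subst prob_eq_1) auto

text \<open>
  By self-similarity the mean \<open>m\<close> is a fixed point of the averaged maps, which leaves the linear
  equation \<open>m = 4/9 * m + 5/18\<close>.
\<close>

lemma centroid_unit_interval: "centroid P {0..1} = 1/2"
proof -
  define m where "m = (LINT x:{0..1}|P. x)"
  define f where "f x = indicator {0..1} x * x" for x :: real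
  have f [measurable]: "f \<in> borel_measurable borel" unfolding f_def by measurable
  have pull: "(\<integral>x. f (ifs_map i x) \<partial>P) = 4/9 * m + ifs_map i 0" for i
  proof -
    have "(\<integral>x. f (ifs_map i x) \<partial>P) = (LINT x:{0..1}|P. 4/9 * x + ifs_map i 0)"
      unfolding set_lebesgue_integral_def
    proof (rule integral_cong_AE)
      show "AE x in P. f (ifs_map i x) = indicator {0..1} x *\<^sub>R (4/9 * x + ifs_map i 0)"
        using AE_unit_interval AE_ifs_map_unit_interval[of i]
      proof eventually_elim
        case (elim x)
        then show ?case using ifs_map_affine[of i x] by (simp add: f_def)
      qed
    qed measurable
    also have "\<dots> = 4/9 * m + ifs_map i 0"
      unfolding m_def by (subst set_integral_affine) (auto simp: measure_unit_interval)
    finally show ?thesis .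
  qed
  have "(\<integral>x. f x \<partial>P) = m" by (simp add: m_def f_def set_lebesgue_integral_def)
  moreover have "(\<integral>x. f x \<partial>P) = 1/2 * (\<integral>x. f (ifs_map 1 x) \<partial>P) + 1/2 * (\<integral>x. f (ifs_map 2 x) \<partial>P)"
    by (rule integral_self_sim[where C=1]) (auto simp: f_def indicator_def)
  ultimately have "m = 1/2 * (4/9 * m + ifs_map 1 0) + 1/2 * (4/9 * m + ifs_map 2 0)"
    by (simp only: pull)
  then have "m = 1/2" by (simp add: ifs_map_def field_simps)
  then show ?thesis by (simp add: centroid_def measure_unit_interval flip: m_def)
qed

lemma measure_word_interval: "measure P (word_interval w) = (1/2) ^ length w"
  unfolding word_interval_def by (subst measure_word_image) (auto simp: measure_unit_interval)

lemma centroid_word_interval: "centroid P (word_interval w) = word_map w (1/2)"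
  unfolding word_interval_def
  by (subst centroid_word_image) (auto simp: measure_unit_interval centroid_unit_interval)

text \<open>
  A different set of full measure may be chosen in each block of level \<open>m\<close>, as is needed when
  the blocks are cut in different ways.
\<close>

lemma AE_word_images:
  assumes "\<And>w. w \<in> words m \<Longrightarrow> B w \<in> sets borel"
    and "\<And>w. w \<in> words m \<Longrightarrow> AE x in P. x \<in> B w"
  shows "AE x in P. \<exists>w\<in>words m. x \<in> word_map w ` B w"
  using assms
proof (induction m arbitrary: B)
  case 0
  then show ?case by (simp add: words_0 image_def)
next
  case (Suc m)
  define C where "C i = (\<Union>w\<in>words m. word_map w ` B (i # w))" for i
  have CB: "C i \<in> sets borel" and CA: "AE x in P. x \<in> C i" if "i \<in> {1, 2}" for i
  proof -
    have mem: "i # w \<in> words (Suc m)" if "w \<in> words m" for w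
      using that \<open>i \<in> {1, 2}\<close> by (auto simp: words_Suc)
    show "C i \<in> sets borel" unfolding C_def
      by (intro sets.finite_UN finite_words word_map_image_borel Suc.prems(1) mem)
    have "AE x in P. \<exists>w\<in>words m. x \<in> word_map w ` B (i # w)"
      by (rule Suc.IH) (use Suc.prems mem in auto)
    then show "AE x in P. x \<in> C i" by (simp add: C_def)
  qed
  define D where "D = ifs_map 1 ` C 1 \<union> ifs_map 2 ` C 2"
  have DB: "D \<in> sets borel" unfolding D_def by (intro sets.Un ifs_map_image_borel CB) auto
  have vimage: "ifs_map i -` D \<in> sets borel" for i
    using measurable_sets[OF ifs_map_measurable DB, of i] by simp
  have "measure P (ifs_map i -` D) = 1" if "i \<in> {1, 2}" for i
  proof -
    have "measure P (C i) \<le> measure P (ifs_map i -` D)"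
      by (rule finite_measure_mono) (use that vimage in \<open>auto simp: D_def\<close>)
    moreover have "measure P (C i) = 1" using CA[OF that] CB[OF that] by (subst prob_eq_1) auto
    ultimately show ?thesis by (simp add: measure_ge_1_iff)
  qed
  then have "measure P D = 1" using self_sim[OF DB] by simp
  then have "AE x in P. x \<in> D" using DB by (subst (asm) prob_eq_1) auto
  moreover have "D = (\<Union>w\<in>words (Suc m). word_map w ` B w)"
    by (simp add: D_def C_def words_Suc image_UN UN_Un image_image)
  ultimately show ?case by simp
qed

end

section \<open>Voronoi regions of mixed tessellations\<close>

definition cell :: "nat list set \<Rightarrow> real set" where
  "cell W = (\<Union>w\<in>W. word_interval w)"

lemma words_centroid_cell: "words_centroid P W = centroid P (cell W)"
  by (simp add: words_centroid_def cell_def)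

lemma cell_borel: "finite W \<Longrightarrow> cell W \<in> sets borel"
  unfolding cell_def by (intro sets.finite_UN word_interval_borel)

lemma cell_subset: "cell W \<subseteq> {0..1}"
  unfolding cell_def using word_interval_subset by blast

lemma cell_prefix: "cell ((@) v ` W) = word_map v ` cell W"
  by (simp add: cell_def word_interval_append image_UN)

lemma voronoi_region_eq:
  assumes "finite \<alpha>" "a \<in> \<alpha>"
  shows "voronoi_region a \<alpha> = (\<Inter>b\<in>\<alpha>. {x. \<bar>x - a\<bar> \<le> \<bar>x - b\<bar>})"
proof -
  have "\<bar>x - a\<bar> = Min ((\<lambda>b. \<bar>x - b\<bar>) ` \<alpha>) \<longleftrightarrow> (\<forall>b\<in>\<alpha>. \<bar>x - a\<bar> \<le> \<bar>x - b\<bar>)" for x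
    using assms by (subst eq_commute, subst Min_eq_iff) auto
  then show ?thesis by (auto simp: voronoi_region_def)
qed

lemma voronoi_region_closed:
  assumes "finite \<alpha>" "a \<in> \<alpha>" shows "closed (voronoi_region a \<alpha>)"
  unfolding voronoi_region_eq[OF assms]
  by (intro closed_INT ballI closed_Collect_le continuous_intros)

context self_similar
begin

text \<open>
  A verification principle that avoids computing Voronoi regions.  If cells of positive mass
  cover almost everything and each is strictly closest to its own centroid, then the Voronoi
  region of that centroid differs from the cell by a null set, so it has the same mass and the
  same centroid.  The cells are indexed because distinctness of the centroids
  is a consequence of the strict inequality.
\<close>

lemma CVT_of_cells:
  fixes p :: "'i \<Rightarrow> real" and U :: "'i \<Rightarrow> real set"
  assumes fin: "finite I"
    and U: "\<And>i. i \<in> I \<Longrightarrow> U i \<in> sets borel"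
    and pos: "\<And>i. i \<in> I \<Longrightarrow> 0 < measure P (U i)"
    and cen: "\<And>i. i \<in> I \<Longrightarrow> centroid P (U i) = p i"
    and cover: "AE x in P. \<exists>i\<in>I. x \<in> U i"
    and near: "\<And>i j x. i \<in> I \<Longrightarrow> j \<in> I \<Longrightarrow> i \<noteq> j \<Longrightarrow> x \<in> U i \<Longrightarrow> \<bar>x - p i\<bar> < \<bar>x - p j\<bar>"
  shows "CVT P (card I) (p ` I)"
proof -
  have nonempty: "U i \<noteq> {}" if "i \<in> I" for i using pos[OF that] by auto
  have inj: "inj_on p I"
  proof (rule inj_onI)
    fix i j assume ij: "i \<in> I" "j \<in> I" "p i = p j"
    obtain x where "x \<in> U i" using nonempty[OF ij(1)] by blast
    then show "i = j" using near[of i j x] ij by fastforce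
  qed
  have region: "AE x in P. x \<in> U i \<longleftrightarrow> x \<in> voronoi_region (p i) (p ` I)" if i: "i \<in> I" for i
    using cover
  proof eventually_elim
    case (elim x)
    then obtain j where j: "j \<in> I" "x \<in> U j" by blast
    have le: "\<bar>x - p j\<bar> \<le> \<bar>x - p k\<bar>" if "k \<in> I" for k
      using near[OF j(1) that _ j(2)] by (cases "j = k") auto
    show ?case
    proof (cases "i = j")
      case True
      then show ?thesis using le j i fin by (auto simp: voronoi_region_eq)
    next
      case False
      then have "x \<notin> voronoi_region (p i) (p ` I)"
        using near[OF j(1) i _ j(2)] i j fin by (auto simp: voronoi_region_eq not_le)
      moreover have "x \<notin> U i"
        using near[OF i j(1) False, of x] near[OF j(1) i _ j(2)] False by fastforce
      ultimately show ?thesis by simp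
    qed
  qed
  have "0 < measure P (voronoi_region (p i) (p ` I)) \<and> p i = centroid P (voronoi_region (p i) (p ` I))"
    if i: "i \<in> I" for i
  proof -
    let ?V = "voronoi_region (p i) (p ` I)"
    have V: "?V \<in> sets borel" by (rule borel_closed, rule voronoi_region_closed) (use fin i in auto)
    have m: "measure P (U i) = measure P ?V"
      by (rule measure_eq_AE[OF region[OF i]]) (simp_all add: U[OF i] V)
    have "(LINT x:U i|P. x) = (LINT x:?V|P. x)"
      unfolding set_lebesgue_integral_def
    proof (rule integral_cong_AE)
      show "AE x in P. indicator (U i) x *\<^sub>R x = indicator ?V x *\<^sub>R x"
        using region[OF i] by eventually_elim (simp add: indicator_def)
    qed (use U[OF i] V in measurable)
    with m cen[OF i] pos[OF i] show ?thesis by (simp add: centroid_def)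
  qed
  with fin show ?thesis by (auto simp: CVT_def card_image[OF inj])
qed

lemma measure_cell_pos:
  assumes "finite W" "W \<noteq> {}" shows "0 < measure P (cell W)"
proof -
  obtain w where "w \<in> W" using assms by blast
  then have "measure P (word_interval w) \<le> measure P (cell W)"
    by (intro finite_measure_mono) (auto simp: cell_def intro!: cell_borel[OF assms(1), unfolded cell_def])
  then show ?thesis using measure_word_interval[of w] by (auto intro: less_le_trans[rotated])
qed

lemma words_centroid_prefix:
  assumes "finite W" "W \<noteq> {}"
  shows "words_centroid P ((@) v ` W) = word_map v (words_centroid P W)"
  using centroid_word_image[OF cell_borel cell_subset measure_cell_pos] assms
  by (simp add: words_centroid_cell cell_prefix)

lemma measure_cell:
  assumes "finite W" "disjoint_family_on word_interval W"
  shows "measure P (cell W) = (\<Sum>w\<in>W. (1/2) ^ length w)"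
  unfolding cell_def using assms
  by (subst finite_measure_finite_Union) (auto simp: measure_word_interval)

text \<open>
  Mass and first moment are additive over disjoint cylinders, and a cylinder has its midpoint as
  centroid.  This turns every centroid in the theorem into an explicit fraction.
\<close>

lemma words_centroid_eq:
  assumes W: "finite W" "disjoint_family_on word_interval W"
  shows "words_centroid P W = (\<Sum>w\<in>W. (1/2) ^ length w * word_map w (1/2)) / (\<Sum>w\<in>W. (1/2) ^ length w)"
proof -
  have "(LINT x:word_interval w|P. x) = (1/2) ^ length w * word_map w (1/2)" for w
    using centroid_word_interval[of w] by (simp add: centroid_def measure_word_interval field_simps)
  moreover have "(LINT x:cell W|P. x) = (\<Sum>w\<in>W. LINT x:word_interval w|P. x)"
    unfolding cell_def
    by (rule set_integral_finite_Union) (use W set_integrable_id word_interval_subset in auto)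
  ultimately show ?thesis
    by (simp add: words_centroid_cell centroid_def measure_cell[OF W])
qed

text \<open>
  The local properties of a cut of the unit interval into cells (unions of cylinders, given by
  their words).  The point \<open>2 * x - a\<close> is the mirror image of \<open>a\<close> in \<open>x\<close>, and the points at least
  as close to \<open>x\<close> as \<open>a\<close> are those between \<open>a\<close> and this mirror image.  Confining it to a
  neighbourhood of radius \<open>1/5\<close> makes the cut insensitive to whatever is done in other blocks.
\<close>

definition tessellates :: "nat list set set \<Rightarrow> bool" where
  "tessellates T \<longleftrightarrow>
     finite T \<and> (\<forall>W\<in>T. finite W \<and> W \<noteq> {}) \<and>
     (AE x in P. \<exists>W\<in>T. x \<in> cell W) \<and>
     (\<forall>W\<in>T. words_centroid P W \<in> {0..1}) \<and>
     (\<forall>W\<in>T. \<forall>x\<in>cell W. 2 * x - words_centroid P W \<in> {-1/5..6/5}) \<and>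
     (\<forall>W\<in>T. \<forall>V\<in>T. V \<noteq> W \<longrightarrow> (\<forall>x\<in>cell W. \<bar>x - words_centroid P W\<bar> < \<bar>x - words_centroid P V\<bar>))"

text \<open>
  A point \<open>word_map w b\<close> that is at least as close as \<open>word_map v a\<close> would, in the coordinates of
  the block of \<open>v\<close>, lie between \<open>a\<close> and its mirror image in \<open>x\<close>, hence in the enlarged block,
  which is disjoint from the block of \<open>w\<close>.
\<close>

lemma nearest_across_blocks:
  assumes v: "v \<in> words m" and w: "w \<in> words m" and "v \<noteq> w"
    and a: "a \<in> {0..1}" and r: "2 * x - a \<in> {-1/5..6/5}" and b: "b \<in> {0..1}"
  shows "\<bar>word_map v x - word_map v a\<bar> < \<bar>word_map v x - word_map w b\<bar>"
proof (rule ccontr)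
  assume neg: "\<not> ?thesis"
  \<comment> \<open>The competing point in the coordinates of the block of \<open>v\<close>.\<close>
  obtain c where c: "word_map w b = word_map v c" using surj_word_map by blast
  have "\<bar>x - c\<bar> \<le> \<bar>x - a\<bar>" using neg unfolding c abs_word_map_diff by (simp add: not_less)
  then have "c \<in> {-1/5..6/5}" using a r by (auto simp: abs_le_iff abs_if split: if_splits)
  then show False using halo_disjoint[of v w c b] v w \<open>v \<noteq> w\<close> b c by (auto simp: words_def)
qed

text \<open>
  The blocks may be cut independently of each other: inside a block the strict inequalities of
  \<open>tessellates\<close> are only rescaled, and across blocks the preceding lemma applies.
\<close>

lemma CVT_of_tessellations:
  assumes T: "\<And>w. w \<in> words m \<Longrightarrow> tessellates (T w)"
  shows "CVT P (\<Sum>w\<in>words m. card (T w)) (\<Union>w\<in>words m. word_map w ` words_centroid P ` T w)"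
proof -
  define I where "I = Sigma (words m) T"
  define p where "p = (\<lambda>(w, W). word_map w (words_centroid P W))"
  define U where "U = (\<lambda>(w, W). word_map w ` cell W)"
  have "CVT P (card I) (p ` I)"
  proof (rule CVT_of_cells)
    show "finite I"
      unfolding I_def using finite_words T by (intro finite_SigmaI) (auto simp: tessellates_def)
  next
    fix i assume "i \<in> I"
    then obtain w W where i: "i = (w, W)" and "w \<in> words m" "W \<in> T w" by (auto simp: I_def)
    then have W: "finite W" "W \<noteq> {}" using T by (auto simp: tessellates_def)
    show "U i \<in> sets borel" by (simp add: i U_def word_map_image_borel cell_borel W)
    show "0 < measure P (U i)"
      by (simp add: i U_def measure_word_image cell_borel cell_subset W measure_cell_pos)
    show "centroid P (U i) = p i"
      by (simp add: i U_def p_def words_centroid_cell centroid_word_image cell_borel cell_subset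
          W measure_cell_pos)
  next
    have fin: "finite (T w)" "W \<in> T w \<Longrightarrow> finite W" if "w \<in> words m" for w W
      using T[OF that] by (auto simp: tessellates_def)
    have "AE x in P. \<exists>w\<in>words m. x \<in> word_map w ` (\<Union>W\<in>T w. cell W)"
    proof (rule AE_word_images)
      fix w assume w: "w \<in> words m"
      show "(\<Union>W\<in>T w. cell W) \<in> sets borel"
        using fin[OF w] by (intro sets.finite_UN cell_borel)
      show "AE x in P. x \<in> (\<Union>W\<in>T w. cell W)"
        using T[OF w] by (simp add: tessellates_def)
    qed
    then show "AE x in P. \<exists>i\<in>I. x \<in> U i"
      by eventually_elim (fastforce simp: I_def U_def)
  next
    fix i j x assume "i \<in> I" "j \<in> I" and ne: "i \<noteq> j" and "x \<in> U i"
    then obtain v V w W where ij: "i = (v, V)" "j = (w, W)"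
      and v: "v \<in> words m" "V \<in> T v" and w: "w \<in> words m" "W \<in> T w"
      by (auto simp: I_def)
    with \<open>x \<in> U i\<close> obtain y where y: "y \<in> cell V" "x = word_map v y" by (auto simp: U_def)
    show "\<bar>x - p i\<bar> < \<bar>x - p j\<bar>"
    proof (cases "v = w")
      case True
      then have "\<bar>y - words_centroid P V\<bar> < \<bar>y - words_centroid P W\<bar>"
        using T[OF v(1)] v w y ne ij by (auto simp: tessellates_def)
      then show ?thesis by (simp add: ij y p_def True abs_word_map_diff)
    next
      case False
      have "\<bar>word_map v y - word_map v (words_centroid P V)\<bar>
          < \<bar>word_map v y - word_map w (words_centroid P W)\<bar>"
        by (rule nearest_across_blocks[OF v(1) w(1) False])
          (use T[OF v(1)] T[OF w(1)] v w y in \<open>auto simp: tessellates_def simp del: atLeastAtMost_iff\<close>)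
      then show ?thesis by (simp add: ij y p_def)
    qed
  qed
  moreover have "card I = (\<Sum>w\<in>words m. card (T w))"
    unfolding I_def using finite_words T by (subst card_SigmaI) (auto simp: tessellates_def)
  moreover have "p ` I = (\<Union>w\<in>words m. word_map w ` words_centroid P ` T w)"
    by (force simp: I_def p_def)
  ultimately show ?thesis by simp
qed

end

section \<open>The three basic cuts of the unit interval\<close>

definition left_split :: "nat list set set" where
  "left_split = {{[1,1], [1,2,1], [1,2,2,1]}, {[1,2,2,2], [2,1]}, {[2,2]}}"

definition right_split :: "nat list set set" where
  "right_split = {{[1,1]}, {[1,2], [2,1,1,1]}, {[2,1,1,2], [2,1,2], [2,2]}}"

definition quarter_split :: "nat list set set" where
  "quarter_split = {{[1,1]}, {[1,2]}, {[2,1]}, {[2,2]}}"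

lemmas split_defs = left_split_def right_split_def quarter_split_def

text \<open>
  Cells are told apart by a word that belongs to only one of them.  This is needed both to count
  the cells and to discharge the condition \<open>V \<noteq> W\<close> in \<open>tessellates\<close>.
\<close>

lemma left_cells_distinct:
  "{[1,1], [1,2,1], [1,2,2,1]} \<noteq> {[1,2,2,2], [2,1::nat]}"
  "{[1,1], [1,2,1], [1,2,2,1]} \<noteq> {[2,2::nat]}"
  "{[1,2,2,2], [2,1]} \<noteq> {[2,2::nat]}"
proof -
  have "[1,1] \<notin> {[1,2,2,2], [2,1::nat]}" "[1,1] \<notin> {[2,2::nat]}" "[2,1] \<notin> {[2,2::nat]}"
    by simp_all
  then show "{[1,1], [1,2,1], [1,2,2,1]} \<noteq> {[1,2,2,2], [2,1::nat]}"
    "{[1,1], [1,2,1], [1,2,2,1]} \<noteq> {[2,2::nat]}"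
    "{[1,2,2,2], [2,1]} \<noteq> {[2,2::nat]}" by (metis insertI1 insertI2)+
qed

lemma right_cells_distinct:
  "{[2,1,1,2], [2,1,2], [2,2]} \<noteq> {[1,2], [2,1,1,1::nat]}"
  "{[2,1,1,2], [2,1,2], [2,2]} \<noteq> {[1,1::nat]}"
  "{[1,2], [2,1,1,1]} \<noteq> {[1,1::nat]}"
proof -
  have "[2,2] \<notin> {[1,2], [2,1,1,1::nat]}" "[2,2] \<notin> {[1,1::nat]}" "[1,2] \<notin> {[1,1::nat]}"
    by simp_all
  then show "{[2,1,1,2], [2,1,2], [2,2]} \<noteq> {[1,2], [2,1,1,1::nat]}"
    "{[2,1,1,2], [2,1,2], [2,2]} \<noteq> {[1,1::nat]}"
    "{[1,2], [2,1,1,1]} \<noteq> {[1,1::nat]}" by (metis insertI1 insertI2)+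
qed

lemma card_splits:
  "card left_split = 3" "card right_split = 3" "card quarter_split = 4"
proof -
  show "card left_split = 3" unfolding left_split_def
    using left_cells_distinct
    by (simp only: card_insert_if finite.intros insert_iff empty_iff card.empty) simp
  show "card right_split = 3" unfolding right_split_def
    using right_cells_distinct right_cells_distinct[symmetric]
    by (simp only: card_insert_if finite.intros insert_iff empty_iff card.empty) simp
  show "card quarter_split = 4" by (simp add: quarter_split_def)
qed

lemma words_2: "words 2 = {[1,1], [1,2], [2,1], [2,2]}"
  by (auto simp: numeral_2_eq_2 words_Suc words_0)

context self_similar
begin

lemma left_centroids:
  "words_centroid P {[1,1], [1,2,1], [1,2,2,1]} = 1268/6561"
  "words_centroid P {[1,2,2,2], [2,1]} = 3992/6561"
  by (subst words_centroid_eq;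
      simp add: disjoint_family_on_def word_interval_eq ifs_map_def)+

lemma right_centroids:
  "words_centroid P {[1,2], [2,1,1,1]} = 2569/6561"
  "words_centroid P {[2,1,1,2], [2,1,2], [2,2]} = 5293/6561"
  by (subst words_centroid_eq;
      simp add: disjoint_family_on_def word_interval_eq ifs_map_def)+

lemma words_centroid_single: "words_centroid P {w} = word_map w (1/2)"
  by (simp add: words_centroid_cell cell_def centroid_word_interval)

lemma quarter_centroids:
  "words_centroid P {[1,1]} = 8/81" "words_centroid P {[1,2]} = 28/81"
  "words_centroid P {[2,1]} = 53/81" "words_centroid P {[2,2]} = 73/81"
  by (simp_all add: words_centroid_single ifs_map_def)

lemmas split_centroids = left_centroids right_centroids quarter_centroids

text \<open>
  The covering condition reduces to a finite sum, because the masses of disjoint cylinders add up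
  and \<open>P\<close> has total mass one.
\<close>

lemma AE_cells:
  assumes W: "finite T" "\<forall>W\<in>T. finite W" "disjoint_family_on word_interval (\<Union>T)"
    and total: "(\<Sum>w\<in>\<Union>T. (1/2) ^ length w) = (1 :: real)"
  shows "AE x in P. \<exists>W\<in>T. x \<in> cell W"
proof -
  have "finite (\<Union>T)" using W by auto
  then have "measure P (cell (\<Union>T)) = 1" using measure_cell[of "\<Union>T"] W total by simp
  then have "AE x in P. x \<in> cell (\<Union>T)"
    using cell_borel[OF \<open>finite (\<Union>T)\<close>] by (subst (asm) prob_eq_1) auto
  then show ?thesis by eventually_elim (auto simp: cell_def)
qed

text \<open>
  After inserting the explicit centroids and the end points of the cylinders, all conditions are
  inequalities between fractions.  The margins are small: the midpoint \<open>9905/13122\<close> of the last two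
  centroids is barely to the right of \<open>61/81 = 9882/13122\<close>, where the cylinder of the word
  \<open>21\<close> ends, and the mirror image of \<open>1268/6561\<close> in \<open>0\<close> is just above \<open>-1/5\<close>.
\<close>

lemma tessellates_left: "tessellates left_split"
  unfolding tessellates_def
proof (intro conjI)
  show "AE x in P. \<exists>W\<in>left_split. x \<in> cell W"
    by (rule AE_cells)
      (simp_all add: left_split_def disjoint_family_on_def word_interval_eq ifs_map_def)
  show "\<forall>W\<in>left_split. \<forall>x\<in>cell W. 2 * x - words_centroid P W \<in> {-1/5..6/5}"
    by (simp add: left_split_def split_centroids[unfolded One_nat_def] cell_def word_interval_eq ifs_map_def)
  show "\<forall>W\<in>left_split. \<forall>V\<in>left_split. V \<noteq> W \<longrightarrow>
      (\<forall>x\<in>cell W. \<bar>x - words_centroid P W\<bar> < \<bar>x - words_centroid P V\<bar>)"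
    using left_cells_distinct left_cells_distinct[symmetric]
    by (simp add: left_split_def split_centroids[unfolded One_nat_def] cell_def word_interval_eq ifs_map_def
        ball_Un abs_if)
qed (simp_all add: left_split_def split_centroids[unfolded One_nat_def])

text \<open>
  This cut is the mirror image of the preceding one in the point \<open>1/2\<close>.
\<close>

lemma tessellates_right: "tessellates right_split"
  unfolding tessellates_def
proof (intro conjI)
  show "AE x in P. \<exists>W\<in>right_split. x \<in> cell W"
    by (rule AE_cells)
      (simp_all add: right_split_def disjoint_family_on_def word_interval_eq ifs_map_def)
  show "\<forall>W\<in>right_split. \<forall>x\<in>cell W. 2 * x - words_centroid P W \<in> {-1/5..6/5}"
    by (simp add: right_split_def split_centroids[unfolded One_nat_def] cell_def word_interval_eq ifs_map_def)
  show "\<forall>W\<in>right_split. \<forall>V\<in>right_split. V \<noteq> W \<longrightarrow>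
      (\<forall>x\<in>cell W. \<bar>x - words_centroid P W\<bar> < \<bar>x - words_centroid P V\<bar>)"
    using right_cells_distinct right_cells_distinct[symmetric]
    by (simp add: right_split_def split_centroids[unfolded One_nat_def] cell_def word_interval_eq ifs_map_def
        ball_Un abs_if)
qed (simp_all add: right_split_def split_centroids[unfolded One_nat_def])

lemma tessellates_quarter: "tessellates quarter_split"
  unfolding tessellates_def
proof (intro conjI)
  show "AE x in P. \<exists>W\<in>quarter_split. x \<in> cell W"
    by (rule AE_cells)
      (simp_all add: quarter_split_def disjoint_family_on_def word_interval_eq ifs_map_def)
  show "\<forall>W\<in>quarter_split. \<forall>x\<in>cell W. 2 * x - words_centroid P W \<in> {-1/5..6/5}"
    by (simp add: quarter_split_def split_centroids[unfolded One_nat_def] cell_def word_interval_eq ifs_map_def)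
  show "\<forall>W\<in>quarter_split. \<forall>V\<in>quarter_split. V \<noteq> W \<longrightarrow>
      (\<forall>x\<in>cell W. \<bar>x - words_centroid P W\<bar> < \<bar>x - words_centroid P V\<bar>)"
    by (simp add: quarter_split_def split_centroids[unfolded One_nat_def] cell_def word_interval_eq ifs_map_def
        ball_Un abs_if)
qed (simp_all add: quarter_split_def split_centroids[unfolded One_nat_def])

end

section \<open>Counting the configurations\<close>

definition chosen_split :: "nat list set \<Rightarrow> nat list set \<Rightarrow> nat list \<Rightarrow> nat list set set" where
  "chosen_split J G w = (if w \<in> J then quarter_split else if w \<in> G then left_split else right_split)"

context self_similar
begin

definition configuration :: "nat \<Rightarrow> nat list set \<Rightarrow> nat list set \<Rightarrow> real set" where
  "configuration m J G = (\<Union>w\<in>words m. word_map w ` words_centroid P ` chosen_split J G w)"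

lemma tessellates_chosen_split: "tessellates (chosen_split J G w)"
  by (simp add: chosen_split_def tessellates_left tessellates_right tessellates_quarter)

lemma split_points_distinct:
  "words_centroid P ` left_split \<noteq> words_centroid P ` right_split"
  "words_centroid P ` left_split \<noteq> words_centroid P ` quarter_split"
  "words_centroid P ` right_split \<noteq> words_centroid P ` quarter_split"
proof -
  have "3992/6561 \<in> words_centroid P ` left_split"
    and "2569/6561 \<in> words_centroid P ` right_split"
    and "3992/6561 \<notin> words_centroid P ` right_split"
    and "3992/6561 \<notin> words_centroid P ` quarter_split"
    and "2569/6561 \<notin> words_centroid P ` quarter_split"
    by (simp_all add: split_defs split_centroids[unfolded One_nat_def])
  then show "words_centroid P ` left_split \<noteq> words_centroid P ` right_split"
    "words_centroid P ` left_split \<noteq> words_centroid P ` quarter_split"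
    "words_centroid P ` right_split \<noteq> words_centroid P ` quarter_split" by metis+
qed

lemma triple_left_eq: "triple_left P w = word_map w ` words_centroid P ` left_split"
proof -
  have "triple_left P w = (\<lambda>W. words_centroid P ((@) w ` W)) ` left_split"
    by (simp add: triple_left_def left_split_def)
  also have "\<dots> = (\<lambda>W. word_map w (words_centroid P W)) ` left_split"
    by (intro image_cong refl words_centroid_prefix) (auto simp: left_split_def)
  finally show ?thesis by (simp add: image_image)
qed

lemma triple_right_eq: "triple_right P w = word_map w ` words_centroid P ` right_split"
proof -
  have "triple_right P w = (\<lambda>W. words_centroid P ((@) w ` W)) ` right_split"
    by (simp add: triple_right_def right_split_def)
  also have "\<dots> = (\<lambda>W. word_map w (words_centroid P W)) ` right_split"
    by (intro image_cong refl words_centroid_prefix) (auto simp: right_split_def)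
  finally show ?thesis by (simp add: image_image)
qed

lemma quarter_points: "word_map w ` words_centroid P ` quarter_split = {word_map (w @ v) (1/2) |v. v \<in> words 2}"
proof -
  have q: "quarter_split = (\<lambda>v. {v}) ` words 2" by (auto simp: quarter_split_def words_2)
  have "word_map w ` words_centroid P ` quarter_split = (\<lambda>v. word_map (w @ v) (1/2)) ` words 2"
    unfolding q by (simp add: words_centroid_single word_map_append image_image)
  then show ?thesis by blast
qed

lemma alpha_set_eq_configuration:
  assumes J: "J \<subseteq> words m"
    and A: "\<And>w. w \<in> words m - J \<Longrightarrow> A w = (if w \<in> G then triple_left P w else triple_right P w)"
  shows "alpha_set A m J = configuration m J G"
proof -
  have "(\<Union>w\<in>words m - J. A w) = (\<Union>w\<in>words m - J. word_map w ` words_centroid P ` chosen_split J G w)"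
    by (intro SUP_cong refl) (simp add: A chosen_split_def triple_left_eq triple_right_eq)
  moreover have "{word_map (w @ v) (1/2) |w v. w \<in> J \<and> v \<in> words 2}
      = (\<Union>w\<in>J. word_map w ` words_centroid P ` chosen_split J G w)"
    by (auto simp: chosen_split_def quarter_points)
  moreover have "(\<Union>w\<in>words m. f w) = (\<Union>w\<in>words m - J. f w) \<union> (\<Union>w\<in>J. f w)"
    for f :: "nat list \<Rightarrow> real set" using J by blast
  ultimately show ?thesis by (simp only: alpha_set_def configuration_def)
qed

text \<open>
  All points contributed by a block stay inside it, so a configuration can be read off
  block by block.
\<close>

lemma configuration_Int_block:
  assumes w: "w \<in> words m"
  shows "configuration m J G \<inter> word_interval w = word_map w ` words_centroid P ` chosen_split J G w"
proof -
  have sub: "word_map v ` words_centroid P ` chosen_split J G v \<subseteq> word_interval v" for v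
  proof -
    have "words_centroid P ` chosen_split J G v \<subseteq> {0..1}"
      using tessellates_chosen_split[of J G v] by (simp add: tessellates_def image_subset_iff)
    then show ?thesis unfolding word_interval_def by (rule image_mono)
  qed
  show ?thesis
  proof (intro equalityI subsetI)
    fix x assume "x \<in> configuration m J G \<inter> word_interval w"
    then obtain v where v: "v \<in> words m" "x \<in> word_map v ` words_centroid P ` chosen_split J G v"
      and "x \<in> word_interval w" unfolding configuration_def by blast
    moreover have "x \<in> word_interval v" using v(2) sub by (rule subsetD[rotated])
    ultimately have "v = w" using word_interval_disjoint[OF v(1) w] by blast
    with v show "x \<in> word_map w ` words_centroid P ` chosen_split J G w" by simp
  next
    fix x assume "x \<in> word_map w ` words_centroid P ` chosen_split J G w"
    moreover from this have "x \<in> word_interval w" using sub by (rule subsetD[rotated])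
    ultimately show "x \<in> configuration m J G \<inter> word_interval w"
      using w unfolding configuration_def by (intro IntI UN_I)
  qed
qed

lemma configuration_inject:
  assumes eq: "configuration m J G = configuration m J' G'"
    and sub: "J \<subseteq> words m" "J' \<subseteq> words m" "G \<subseteq> words m - J" "G' \<subseteq> words m - J'"
  shows "J = J' \<and> G = G'"
proof -
  have "(w \<in> J \<longleftrightarrow> w \<in> J') \<and> (w \<in> G \<longleftrightarrow> w \<in> G')" if w: "w \<in> words m" for w
  proof -
    have "word_map w ` words_centroid P ` chosen_split J G w
        = word_map w ` words_centroid P ` chosen_split J' G' w"
      using configuration_Int_block[OF w] eq by metis
    then have "words_centroid P ` chosen_split J G w = words_centroid P ` chosen_split J' G' w"
      by (simp add: inj_image_eq_iff[OF inj_word_map])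
    moreover have "w \<in> G \<Longrightarrow> w \<notin> J" "w \<in> G' \<Longrightarrow> w \<notin> J'" using sub by auto
    moreover have "words_centroid P ` chosen_split J G w = (if w \<in> J then words_centroid P ` quarter_split
        else if w \<in> G then words_centroid P ` left_split else words_centroid P ` right_split)" for J G
      by (simp add: chosen_split_def)
    moreover have "j = j' \<and> g = g'"
      if "L \<noteq> R" "L \<noteq> Q" "R \<noteq> Q" "g \<Longrightarrow> \<not> j" "g' \<Longrightarrow> \<not> j'"
        "(if j then Q else if g then L else R) = (if j' then Q else if g' then L else R)"
      for L R Q :: "real set" and j g j' g'
      using that by (auto split: if_splits)
    ultimately show ?thesis using split_points_distinct by (smt (verit))
  qed
  then show ?thesis using sub by blast
qed

lemma CVT_configuration:
  assumes "J \<subseteq> words m"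
  shows "CVT P (3 * 2 ^ m + card J) (configuration m J G)"
proof -
  have "card (chosen_split J G w) = 3 + (if w \<in> J then 1 else 0)" for w
    by (simp add: chosen_split_def card_splits)
  then have "(\<Sum>w\<in>words m. card (chosen_split J G w)) = 3 * 2 ^ m + card (words m \<inter> J)"
    by (simp add: sum.distrib card_words sum.If_cases[OF finite_words] del: sum.If_cases)
  also have "words m \<inter> J = J" using assms by blast
  finally show ?thesis
    using CVT_of_tessellations[of m "chosen_split J G"] tessellates_chosen_split
    by (simp add: configuration_def)
qed

text \<open>
  Only the values of a choice on the blocks of level \<open>m\<close> outside \<open>J\<close> enter the set, and there
  the choice amounts to the set \<open>G\<close> of blocks with the first triple.
\<close>

lemma alpha_sets_eq_configurations:
  "{alpha_set A m J |J A. J \<subseteq> words m \<and> card J = k \<and> admissible_choice P A}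
   = (\<lambda>(J, G). configuration m J G) ` (SIGMA J:{J. J \<subseteq> words m \<and> card J = k}. Pow (words m - J))"
  (is "?L = ?R")
proof (intro equalityI subsetI)
  fix X assume "X \<in> ?L"
  then obtain J A where X: "X = alpha_set A m J" and J: "J \<subseteq> words m" "card J = k"
    and A: "admissible_choice P A" by blast
  define G where "G = {w \<in> words m - J. A w = triple_left P w}"
  have "X = configuration m J G" unfolding X
    by (rule alpha_set_eq_configuration[OF J(1)]) (use A in \<open>auto simp: G_def admissible_choice_def\<close>)
  then show "X \<in> ?R" using J by (intro image_eqI[where x="(J, G)"]) (auto simp: G_def)
next
  fix X assume "X \<in> ?R"
  then obtain J G where X: "X = configuration m J G" and J: "J \<subseteq> words m" "card J = k" by auto
  define A where "A w = (if w \<in> G then triple_left P w else triple_right P w)" for w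
  have "X = alpha_set A m J"
    unfolding X by (rule alpha_set_eq_configuration[symmetric, OF J(1)]) (simp add: A_def)
  moreover have "admissible_choice P A" by (simp add: admissible_choice_def A_def)
  ultimately show "X \<in> ?L" using J by blast
qed

lemma card_alpha_sets:
  "card {alpha_set A m J |J A. J \<subseteq> words m \<and> card J = k \<and> admissible_choice P A}
   = 2 ^ (2 ^ m - k) * ((2 ^ m) choose k)"
proof -
  let ?S = "SIGMA J:{J. J \<subseteq> words m \<and> card J = k}. Pow (words m - J)"
  have "inj_on (\<lambda>(J, G). configuration m J G) ?S"
  proof (rule inj_onI, clarify)
    fix J G J' G'
    assume "configuration m J G = configuration m J' G'"
      and "J \<subseteq> words m" "J' \<subseteq> words m" "G \<subseteq> words m - J" "G' \<subseteq> words m - J'"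
    then show "J = J' \<and> G = G'" by (rule configuration_inject)
  qed
  then have "card ((\<lambda>(J, G). configuration m J G) ` ?S) = card ?S" by (rule card_image)
  also have "\<dots> = (\<Sum>J | J \<subseteq> words m \<and> card J = k. card (Pow (words m - J)))"
    using finite_words by (intro card_SigmaI) auto
  also have "\<dots> = (\<Sum>J | J \<subseteq> words m \<and> card J = k. 2 ^ (2 ^ m - k))"
  proof (rule sum.cong)
    fix J assume "J \<in> {J. J \<subseteq> words m \<and> card J = k}"
    then have "J \<subseteq> words m" "card J = k" by auto
    moreover from this have "finite J" using finite_words finite_subset by blast
    ultimately show "card (Pow (words m - J)) = 2 ^ (2 ^ m - k)"
      by (simp add: card_Pow finite_words card_Diff_subset card_words)
  qed simp
  also have "\<dots> = 2 ^ (2 ^ m - k) * ((2 ^ m) choose k)"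
    by (simp add: n_subsets[OF finite_words] card_words)
  finally show ?thesis unfolding alpha_sets_eq_configurations .
qed

end

theorem proposition3p12:
  fixes P :: "real measure" and n l k :: nat
  assumes "self_similar_prob P"
    and "l \<ge> 1"
    and "n = 3 * 2 ^ (l - 1) + k"
    and "1 \<le> k" and "k \<le> 2 ^ (l - 1) - 1"
  shows "(\<forall>J A. J \<subseteq> words (l - 1) \<and> card J = k \<and> admissible_choice P A
            \<longrightarrow> CVT P n (alpha_set A (l - 1) J)) \<and>
         card {alpha_set A (l - 1) J | J A.
                 J \<subseteq> words (l - 1) \<and> card J = k \<and> admissible_choice P A}
           = 2 ^ (2 ^ (l + 1) - n) * ((2 ^ (l - 1)) choose (n - 3 * 2 ^ (l - 1)))"
proof -
  interpret self_similar P
    using assms(1) by (simp add: self_similar_prob_def self_similar_def self_similar_axioms_def)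
  have "CVT P n (alpha_set A (l - 1) J)"
    if "J \<subseteq> words (l - 1)" "card J = k" "admissible_choice P A" for J A
  proof -
    have "alpha_set A (l - 1) J \<in> {alpha_set A (l - 1) J |J A.
        J \<subseteq> words (l - 1) \<and> card J = k \<and> admissible_choice P A}" using that by blast
    then show ?thesis unfolding alpha_sets_eq_configurations using CVT_configuration assms(3) by auto
  qed
  moreover have "(2::nat) ^ (l + 1) - n = 2 ^ (l - 1) - k"
  proof -
    have "(2::nat) ^ (l + 1) = 4 * 2 ^ (l - 1)" using assms(2) by (cases l) auto
    then show ?thesis using assms(3) by simp
  qed
  ultimately show ?thesis using card_alpha_sets[of "l - 1" k] assms(3) by simp
qed

end
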